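(* Let $\mathcal{D}$ be a standard second order partial difference operator with polynomial coefficients $A_{i,j},B_i$ ($i,j=1,2$), and let $W:\mathbb{Z}^2\to\mathbb{R}$. Then $W\mathcal{D}$ is self-adjoint if and only if $$W B_1=\Delta_1(WA_{1,1})+\Delta_2(WA_{1,2}),\qquad W B_2=\Delta_1(WA_{2,1})+\Delta_2(WA_{2,2}).$$
   Context: Notation: $e_1=(1,0)$, $e_2=(0,1)$; for a function $u$ of $x=(x_1,x_2)$, $\Delta_i u(x)=u(x+e_i)-u(x)$ and $\nabla_i u(x)=u(x)-u(x-e_i)$. A standard second order partial difference operator is $$\mathcal{D}=A_{1,1}\Delta_1\nabla_1+A_{1,2}\Delta_1\nabla_2+A_{2,1}\Delta_2\nabla_1+A_{2,2}\Delta_2\nabla_2+B_1\Delta_1+B_2\Delta_2,$$ where $A_{i,j},B_i\in\mathbb{R}[x_1,x_2]$. Self-adjointness: $W\mathcal{D}$ is self-adjoint if there are functions $\sigma_{i,j}:\mathbb{Z}^2\to\mathbb{R}$ ($i,j=1,2$) such that $W\mathcal{D}u=\mathcal{E}u$ on $\mathbb{Z}^2$ for every $u:\mathbb{Z}^2\to\mathbb{R}$, where $$\mathcal{E}u=\nabla_1[\sigma_{1,1}\Delta_1u+\sigma_{1,2}\Delta_2u]+\nabla_2[\sigma_{2,1}\Delta_1u+\sigma_{2,2}\Delta_2u].$$ *)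

theory Defs
  imports "HOL-Computational_Algebra.Polynomial" "HOL-Library.Product_Plus"
begin

type_synonym lattice = "int \<times> int"

type_synonym lattice_fun = "lattice \<Rightarrow> real"

definition e1 :: lattice where "e1 = (1, 0)"

definition e2 :: lattice where "e2 = (0, 1)"

definition fwd_diff :: "lattice \<Rightarrow> lattice_fun \<Rightarrow> lattice_fun" where
  "fwd_diff e u = (\<lambda>x. u (x + e) - u x)"

definition bwd_diff :: "lattice \<Rightarrow> lattice_fun \<Rightarrow> lattice_fun" where
  "bwd_diff e u = (\<lambda>x. u x - u (x - e))"

text \<open>\<open>\<real>[x\<^sub>1, x\<^sub>2]\<close> is represented as \<open>\<real>[x\<^sub>1][x\<^sub>2]\<close>: the outer indeterminate is \<open>x\<^sub>2\<close>,
  the inner one \<open>x\<^sub>1\<close>.\<close>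

definition eval2 :: "real poly poly \<Rightarrow> lattice_fun" where
  "eval2 p = (\<lambda>x. poly (poly p [:of_int (snd x):]) (of_int (fst x)))"

definition std_op ::
  "real poly poly \<Rightarrow> real poly poly \<Rightarrow> real poly poly \<Rightarrow> real poly poly \<Rightarrow>
   real poly poly \<Rightarrow> real poly poly \<Rightarrow> lattice_fun \<Rightarrow> lattice_fun" where
  "std_op A11 A12 A21 A22 B1 B2 u = (\<lambda>x.
       eval2 A11 x * fwd_diff e1 (bwd_diff e1 u) x
     + eval2 A12 x * fwd_diff e1 (bwd_diff e2 u) x
     + eval2 A21 x * fwd_diff e2 (bwd_diff e1 u) x
     + eval2 A22 x * fwd_diff e2 (bwd_diff e2 u) x
     + eval2 B1 x * fwd_diff e1 u x
     + eval2 B2 x * fwd_diff e2 u x)"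

definition div_form_op ::
  "lattice_fun \<Rightarrow> lattice_fun \<Rightarrow> lattice_fun \<Rightarrow> lattice_fun \<Rightarrow> lattice_fun \<Rightarrow> lattice_fun" where
  "div_form_op s11 s12 s21 s22 u = (\<lambda>x.
       bwd_diff e1 (\<lambda>y. s11 y * fwd_diff e1 u y + s12 y * fwd_diff e2 u y) x
     + bwd_diff e2 (\<lambda>y. s21 y * fwd_diff e1 u y + s22 y * fwd_diff e2 u y) x)"

definition self_adjoint_op :: "(lattice_fun \<Rightarrow> lattice_fun) \<Rightarrow> bool" where
  "self_adjoint_op L \<longleftrightarrow>
     (\<exists>s11 s12 s21 s22. \<forall>u x. L u x = div_form_op s11 s12 s21 s22 u x)"

end

(* Comparing the coefficients of u(x + e1 - e2), u(x - e2), u(x - e1 + e2), u(x - e1) in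
   W D u = E u (by testing on unit point masses) forces, with a_ij = W A_ij,
     s11(x) = a11(x + e1),  s12(x) = a21(x + e1),  s21(x) = a12(x + e2),  s22(x) = a22(x + e2).
   The coefficients of u(x + e1) and u(x + e2) then give the two stated equations, and the
   coefficient of u(x) is redundant because both operators annihilate constants. *)
theory Submission imports Defs begin

definition point_mass :: "lattice \<Rightarrow> lattice_fun" where
  "point_mass p = (\<lambda>y. if y = p then 1 else 0)"

lemmas lattice_op_defs =
  std_op_def div_form_op_def fwd_diff_def bwd_diff_def e1_def e2_def

lemma div_form_coeffs:
  assumes eq: "\<And>u x. W x * std_op A11 A12 A21 A22 B1 B2 u x = div_form_op s11 s12 s21 s22 u x"
  shows "s11 x = W (x + e1) * eval2 A11 (x + e1)"
    and "s12 x = W (x + e1) * eval2 A21 (x + e1)"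
    and "s21 x = W (x + e2) * eval2 A12 (x + e2)"
    and "s22 x = W (x + e2) * eval2 A22 (x + e2)"
    and "W x * (eval2 A11 x + eval2 A12 x + eval2 B1 x) = s11 x + s21 x"
    and "W x * (eval2 A21 x + eval2 A22 x + eval2 B2 x) = s12 x + s22 x"
proof -
  obtain i j where x: "x = (i, j)" by (cases x)
  \<comment> \<open>In coordinates the simplifier decides which shifted points carry the
    mass.\<close>
  note test = lattice_op_defs point_mass_def x algebra_simps
  \<comment> \<open>The indices cross: at \<open>x + e1\<close> the value \<open>u (x + e2)\<close>
    enters only through \<open>s12 x\<close> on one side and \<open>A21\<close> on the
    other.\<close>
  show 12: "s12 x = W (x + e1) * eval2 A21 (x + e1)"
    using eq[of "x + e1" "point_mass (x + e2)"] by (simp add: test)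
  \<comment> \<open>The mass at \<open>x\<close> only yields \<open>s11 x + s12 x\<close>, so
    \<open>12\<close> is needed to separate the two.\<close>
  show "s11 x = W (x + e1) * eval2 A11 (x + e1)"
    using eq[of "x + e1" "point_mass x"] 12 by (simp add: test)
  show 21: "s21 x = W (x + e2) * eval2 A12 (x + e2)"
    using eq[of "x + e2" "point_mass (x + e1)"] by (simp add: test)
  show "s22 x = W (x + e2) * eval2 A22 (x + e2)"
    using eq[of "x + e2" "point_mass x"] 21 by (simp add: test)
  show "W x * (eval2 A11 x + eval2 A12 x + eval2 B1 x) = s11 x + s21 x"
    using eq[of x "point_mass (x + e1)"] by (simp add: test)
  show "W x * (eval2 A21 x + eval2 A22 x + eval2 B2 x) = s12 x + s22 x"
    using eq[of x "point_mass (x + e2)"] by (simp add: test)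
qed

text \<open>The coefficients forced in \<open>div_form_coeffs\<close> serve as witnesses for the
  converse.\<close>

lemma std_op_eq_div_form_op:
  assumes B1: "W x * eval2 B1 x =
      fwd_diff e1 (\<lambda>y. W y * eval2 A11 y) x + fwd_diff e2 (\<lambda>y. W y * eval2 A12 y) x"
    and B2: "W x * eval2 B2 x =
      fwd_diff e1 (\<lambda>y. W y * eval2 A21 y) x + fwd_diff e2 (\<lambda>y. W y * eval2 A22 y) x"
  shows "W x * std_op A11 A12 A21 A22 B1 B2 u x =
    div_form_op (\<lambda>y. W (y + e1) * eval2 A11 (y + e1)) (\<lambda>y. W (y + e1) * eval2 A21 (y + e1))
      (\<lambda>y. W (y + e2) * eval2 A12 (y + e2)) (\<lambda>y. W (y + e2) * eval2 A22 (y + e2)) u x"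
proof -
  \<comment> \<open>Splitting off the first-order part exposes the products
    \<open>W x * eval2 B1 x\<close> and \<open>W x * eval2 B2 x\<close>, which the hypotheses then
    replace.\<close>
  have "W x * std_op A11 A12 A21 A22 B1 B2 u x =
      W x * std_op A11 A12 A21 A22 0 0 u x
      + (W x * eval2 B1 x) * fwd_diff e1 u x + (W x * eval2 B2 x) * fwd_diff e2 u x"
    by (simp add: std_op_def eval2_def algebra_simps)
  then show ?thesis
    unfolding B1 B2
    by (cases x) (simp add: lattice_op_defs eval2_def algebra_simps)
qed

theorem proposition3p2:
  fixes A11 A12 A21 A22 B1 B2 :: "real poly poly"
    and W :: "int \<times> int \<Rightarrow> real"
  shows "self_adjoint_op (\<lambda>u x. W x * std_op A11 A12 A21 A22 B1 B2 u x) \<longleftrightarrow>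
    (\<forall>x. W x * eval2 B1 x =
           fwd_diff e1 (\<lambda>y. W y * eval2 A11 y) x + fwd_diff e2 (\<lambda>y. W y * eval2 A12 y) x) \<and>
    (\<forall>x. W x * eval2 B2 x =
           fwd_diff e1 (\<lambda>y. W y * eval2 A21 y) x + fwd_diff e2 (\<lambda>y. W y * eval2 A22 y) x)"
    (is "?L \<longleftrightarrow> ?R")
proof
  assume ?L
  then obtain s11 s12 s21 s22 where
    "\<And>u x. W x * std_op A11 A12 A21 A22 B1 B2 u x = div_form_op s11 s12 s21 s22 u x"
    unfolding self_adjoint_op_def by blast
  note s = div_form_coeffs[OF this]
  show ?R
    \<comment> \<open>Moving the unshifted \<open>A\<close> terms to the right turns the shifted
      ones into forward differences.\<close>
    using s(5)[unfolded s(1,3)] s(6)[unfolded s(2,4)]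
    by (simp add: fwd_diff_def algebra_simps)
next
  assume ?R
  then show ?L
    unfolding self_adjoint_op_def using std_op_eq_div_form_op by blast
qed

end
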